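(* Let $\mathcal C_r,\mathcal C_a:\mathbb R^d\to\mathbb R^d$ be (possibly random) compressors with independent internal randomness satisfying, for all $x\in\mathbb R^d$, $$\mathbb E_{\mathcal C_r}\Big[\Big\|\frac{\mathcal C_r(x)}{r_r}-x\Big\|^2\Big]\le(1-\delta_r)\|x\|^2,\qquad \mathbb E_{\mathcal C_a}\Big[\Big\|\frac{\mathcal C_a(x)}{r_a}-x\Big\|^2\Big]\le C_a,$$ where $r_r,r_a>0$, $\delta_r\in(0,1]$, $C_a>0$. Let $\xi$ be a bounded noise with $\|\xi\|\le C_\xi$ almost surely, define $\tilde{\mathcal C}_r(x)=\mathcal C_r(x)+\xi$, $\tilde{\mathcal C}_a(x)=\mathcal C_a(x)+\xi$, and set $$C_{\tilde r}=\frac{(2-\delta_r)C_\xi^2}{\delta_rr_r^2},\qquad C_{\tilde a}=2C_a+\frac{2C_\xi^2}{r_a^2}.$$ Then the composition $x\mapsto\tilde{\mathcal C}_r\big(\tilde{\mathcal C}_a(x)/r_a\big)$ is a globally-bounded compressor with parameters $$r=r_r,\quad C=\frac{(4-\delta_r)C_{\tilde r}}{4-2\delta_r}+\frac{(4-\delta_r)(12-\delta_r)C_{\tilde a}}{4\delta_r},\quad\delta=\frac{\delta_r}8,$$ and the composition $x\mapsto\tilde{\mathcal C}_a(\tilde{\mathcal C}_r(x))$ is a globally-bounded compressor with parameters $$r=r_rr_a,\quad C=\frac{(4-\delta_r)C_{\tilde r}}{4-2\delta_r}+\frac{(4-\delta_r)C_{\tilde a}}{\delta_rr_r^2},\qu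ad\delta=\frac{\delta_r}4.$$
   Context: A (possibly random) map $\mathcal C:\mathbb R^d\to\mathbb R^d$ is a globally-bounded compressor with parameters $r>0$, $C>0$, $\delta\in(0,1]$ if $\mathbb E_{\mathcal C}\big[\big\|\frac{\mathcal C(x)}r-x\big\|^2\big]\le(1-\delta)\|x\|^2+C$ for all $x\in\mathbb R^d$, where $\mathbb E_{\mathcal C}$ is the expectation over the internal randomness of $\mathcal C$ (for the compositions: over the independent internal randomness of both $\mathcal C_r$ and $\mathcal C_a$). Expectations are not taken over the noise; equivalently the inequalities hold uniformly for every noise realization with norm at most $C_\xi$. $\|\cdot\|$ is the Euclidean norm. *)

theory Defs
  imports "HOL-Probability.Probability"
begin

text \<open>
  A random map on a Euclidean space is a deterministic function of its internal randomness
  \<open>\<omega>\<close>, drawn from a probability space, and of its argument. Joint measurability is what makes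
  a composition of two such maps with independent randomness a random map again.
\<close>

definition random_map :: "'w measure \<Rightarrow> ('w \<Rightarrow> real^'d \<Rightarrow> real^'d) \<Rightarrow> bool" where
  "random_map M F \<longleftrightarrow>
     prob_space M \<and> (\<lambda>(\<omega>, x). F \<omega> x) \<in> borel_measurable (M \<Otimes>\<^sub>M borel)"

text \<open>
  Integrability is stated explicitly because the Bochner integral of a non-integrable
  function is \<open>0\<close>, which would make the bound on the expectation hold trivially.
\<close>

definition mean_sq_error_le ::
  "'w measure \<Rightarrow> ('w \<Rightarrow> real^'d \<Rightarrow> real^'d) \<Rightarrow> real \<Rightarrow> real^'d \<Rightarrow> real \<Rightarrow> bool" where
  "mean_sq_error_le M F r x b \<longleftrightarrow>
     integrable M (\<lambda>\<omega>. (norm (F \<omega> x /\<^sub>R r - x))\<^sup>2) \<and>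
     (\<integral>\<omega>. (norm (F \<omega> x /\<^sub>R r - x))\<^sup>2 \<partial>M) \<le> b"

definition globally_bounded_compressor ::
  "'w measure \<Rightarrow> ('w \<Rightarrow> real^'d \<Rightarrow> real^'d) \<Rightarrow> real \<Rightarrow> real \<Rightarrow> real \<Rightarrow> bool" where
  "globally_bounded_compressor M F r C \<delta> \<longleftrightarrow>
     random_map M F \<and> 0 < r \<and> 0 < C \<and> 0 < \<delta> \<and> \<delta> \<le> 1 \<and>
     (\<forall>x. mean_sq_error_le M F r x ((1 - \<delta>) * (norm x)\<^sup>2 + C))"

text \<open>
  The noise enters as a fixed realization \<open>\<xi>\<close>: it is not part of the internal randomness
  over which expectations are taken.
\<close>

definition noisy :: "('w \<Rightarrow> real^'d \<Rightarrow> real^'d) \<Rightarrow> real^'d \<Rightarrow> 'w \<Rightarrow> real^'d \<Rightarrow> real^'d" where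
  "noisy F \<xi> \<omega> x = F \<omega> x + \<xi>"

end

theory Submission
  imports Defs
begin

text \<open>
  Everything rests on Young's inequality
  \<open>\<parallel>a + b\<parallel>\<^sup>2 \<le> (1 + s) \<parallel>a\<parallel>\<^sup>2 + (1 + 1/s) \<parallel>b\<parallel>\<^sup>2\<close>. With \<open>s = \<delta> / (2 (1 - \<delta>))\<close> it absorbs the
  noise into a contraction of factor \<open>1 - \<delta>/2\<close>. With \<open>s = \<delta> / (4 - 2 \<delta>)\<close> it splits the error of
  a composition into the errors of its two factors and leaves the factor \<open>1 - \<delta>/4\<close>. If the
  contraction is applied last, it acts on \<open>y\<close> near \<open>x\<close>, and \<open>s = \<delta> / (8 - 2 \<delta>)\<close> trades \<open>\<parallel>y\<parallel>\<^sup>2\<close>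
  for \<open>\<parallel>x\<parallel>\<^sup>2\<close>. Expectations are computed by Tonelli, first over the outer map and then over the
  inner one.
\<close>

section \<open>Young's inequality and integration of affine bounds\<close>

lemma norm_add_power2_le:
  fixes a b :: "'a::real_inner"
  assumes "0 < s"
  shows "(norm (a + b))\<^sup>2 \<le> (1 + s) * (norm a)\<^sup>2 + (1 + 1 / s) * (norm b)\<^sup>2"
proof -
  \<comment> \<open>Expanded, this quotient is exactly the right-hand side of the claim minus its
    left-hand side.\<close>
  have "0 \<le> (norm (s *\<^sub>R a - b))\<^sup>2 / s"
    using assms by simp
  also have "\<dots> = s * (norm a)\<^sup>2 - 2 * (a \<bullet> b) + (norm b)\<^sup>2 / s"
    unfolding power2_norm_eq_inner using assms by (simp add: inner_diff inner_commute field_simps)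
  finally show ?thesis
    by (simp add: power2_norm_eq_inner inner_add inner_commute algebra_simps)
qed

text \<open>The constant \<open>k\<close> keeps weight one because the total mass is one. Working in
  \<open>ennreal\<close> makes pointwise domination of \<open>h\<close> sufficient, before anything
  is known about its integrability.\<close>

lemma (in prob_space) nn_integral_affine_le:
  fixes f :: "'a \<Rightarrow> real"
  assumes "f \<in> borel_measurable M" "\<And>\<omega>. 0 \<le> f \<omega>" "(\<integral>\<^sup>+\<omega>. f \<omega> \<partial>M) \<le> ennreal b"
    and "0 \<le> b" "0 \<le> c" "0 \<le> k" "\<And>\<omega>. h \<omega> \<le> c * f \<omega> + k"
  shows "(\<integral>\<^sup>+\<omega>. ennreal (h \<omega>) \<partial>M) \<le> ennreal (c * b + k)"
proof -
  have "(\<integral>\<^sup>+\<omega>. ennreal (h \<omega>) \<partial>M) \<le> (\<integral>\<^sup>+\<omega>. ennreal c * ennreal (f \<omega>) + ennreal k \<partial>M)"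
    using assms by (intro nn_integral_mono) (simp add: ennreal_mult[symmetric] ennreal_plus[symmetric] del: ennreal_plus)
  also have "\<dots> = ennreal c * (\<integral>\<^sup>+\<omega>. f \<omega> \<partial>M) + ennreal k"
    using assms by (simp add: nn_integral_add nn_integral_cmult emeasure_space_1)
  also have "\<dots> \<le> ennreal c * ennreal b + ennreal k"
    using assms by (intro add_right_mono mult_left_mono) auto
  also have "\<dots> = ennreal (c * b + k)"
    using assms by (simp add: ennreal_mult)
  finally show ?thesis .
qed

section \<open>Measurability of random maps\<close>

lemma random_map_measurable:
  assumes "random_map M F"
  shows "(\<lambda>\<omega>. F \<omega> x) \<in> borel_measurable M"
proof -
  have [measurable]: "(\<lambda>(\<omega>, x). F \<omega> x) \<in> borel_measurable (M \<Otimes>\<^sub>M borel)"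
    using assms by (simp add: random_map_def)
  have "(\<lambda>\<omega>. (\<lambda>(\<omega>, x). F \<omega> x) (\<omega>, x)) \<in> borel_measurable M"
    by measurable
  then show ?thesis by simp
qed

lemma random_map_noisy:
  assumes "random_map M F"
  shows "random_map M (noisy F \<xi>)"
  using assms by (auto simp: random_map_def noisy_def split_def intro: borel_measurable_add)

lemma random_map_scaleR:
  assumes "random_map M F"
  shows "random_map M (\<lambda>\<omega> x. c *\<^sub>R F \<omega> x)"
  using assms by (auto simp: random_map_def split_def intro: borel_measurable_scaleR)

text \<open>Joint measurability allows the random output of one map to be inserted as the argument
  of the other. Both orders live on the same product space, whose product measure encodes the
  independence of the two sources of randomness.\<close>

lemma random_map_compose:
  assumes F: "random_map M F" and G: "random_map N G"
  shows "random_map (M \<Otimes>\<^sub>M N) (\<lambda>(\<mu>, \<nu>) x. F \<mu> (G \<nu> x))"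
    and "random_map (M \<Otimes>\<^sub>M N) (\<lambda>(\<mu>, \<nu>) x. G \<nu> (F \<mu> x))"
proof -
  have [measurable]: "(\<lambda>(\<mu>, x). F \<mu> x) \<in> borel_measurable (M \<Otimes>\<^sub>M borel)"
    "(\<lambda>(\<nu>, x). G \<nu> x) \<in> borel_measurable (N \<Otimes>\<^sub>M borel)"
    using F G by (auto simp: random_map_def)
  interpret M: prob_space M using F by (simp add: random_map_def)
  interpret N: prob_space N using G by (simp add: random_map_def)
  interpret pair_prob_space M N ..
  have P: "prob_space (M \<Otimes>\<^sub>M N)" by (rule P.prob_space_axioms)
  have "(\<lambda>p. (\<lambda>(\<mu>, x). F \<mu> x) (fst (fst p), (\<lambda>(\<nu>, x). G \<nu> x) (snd (fst p), snd p)))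
      \<in> borel_measurable ((M \<Otimes>\<^sub>M N) \<Otimes>\<^sub>M borel)"
    by measurable
  with P show "random_map (M \<Otimes>\<^sub>M N) (\<lambda>(\<mu>, \<nu>) x. F \<mu> (G \<nu> x))"
    by (simp add: random_map_def split_def)
  have "(\<lambda>p. (\<lambda>(\<nu>, x). G \<nu> x) (snd (fst p), (\<lambda>(\<mu>, x). F \<mu> x) (fst (fst p), snd p)))
      \<in> borel_measurable ((M \<Otimes>\<^sub>M N) \<Otimes>\<^sub>M borel)"
    by measurable
  with P show "random_map (M \<Otimes>\<^sub>M N) (\<lambda>(\<mu>, \<nu>) x. G \<nu> (F \<mu> x))"
    by (simp add: random_map_def split_def)
qed

section \<open>Mean square errors as nonnegative integrals\<close>

text \<open>Passing to the nonnegative integral makes Tonelli available, and finiteness of that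
  integral returns the integrability demanded by \<open>mean_sq_error_le\<close>. The sign of
  \<open>b\<close> matters because \<open>ennreal\<close> sends negative reals to 0.\<close>

lemma mean_sq_error_le_iff_nn_integral:
  assumes "random_map M F" "0 \<le> b"
  shows "mean_sq_error_le M F r x b \<longleftrightarrow>
    (\<integral>\<^sup>+\<omega>. ennreal ((norm (F \<omega> x /\<^sub>R r - x))\<^sup>2) \<partial>M) \<le> ennreal b" (is "_ \<longleftrightarrow> ?I \<le> _")
proof -
  note [measurable] = random_map_measurable[OF assms(1)]
  show ?thesis
  proof
    assume "mean_sq_error_le M F r x b"
    then show "?I \<le> ennreal b"
      by (simp add: mean_sq_error_le_def nn_integral_eq_integral ennreal_leI)
  next
    assume le: "?I \<le> ennreal b"
    have int: "integrable M (\<lambda>\<omega>. (norm (F \<omega> x /\<^sub>R r - x))\<^sup>2)"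
      using le by (intro integrableI_bounded) (auto simp: le_less_trans)
    with le assms(2) show "mean_sq_error_le M F r x b"
      by (simp add: mean_sq_error_le_def nn_integral_eq_integral)
  qed
qed

text \<open>This is the form in which error bounds of single maps are used below: an estimate of
  \<open>h\<close> for each realization becomes an estimate of its expectation.\<close>

lemma mean_sq_error_le_affine:
  assumes F: "random_map M F" and le: "mean_sq_error_le M F r x b"
    and "0 \<le> b" "0 \<le> c" "0 \<le> k"
    and "\<And>\<omega>. h \<omega> \<le> c * (norm (F \<omega> x /\<^sub>R r - x))\<^sup>2 + k"
  shows "(\<integral>\<^sup>+\<omega>. ennreal (h \<omega>) \<partial>M) \<le> ennreal (c * b + k)"
proof -
  note [measurable] = random_map_measurable[OF F]
  interpret prob_space M using F by (simp add: random_map_def)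
  show ?thesis
    using assms by (intro nn_integral_affine_le[where f = "\<lambda>\<omega>. (norm (F \<omega> x /\<^sub>R r - x))\<^sup>2"])
      (auto simp: mean_sq_error_le_iff_nn_integral)
qed

section \<open>Effect of the bounded noise\<close>

text \<open>For each realization the noisy error is the original error plus the fixed vector
  \<open>\<xi> /\<^sub>R r\<close>, to which Young's inequality applies. The weight \<open>s\<close>
  stays free because the relative and the absolute compressor call for different values.\<close>

lemma mean_sq_error_le_noisy:
  assumes F: "random_map M F" and le: "mean_sq_error_le M F r x b"
    and "0 \<le> b" "0 < s" "norm \<xi> \<le> K"
  shows "mean_sq_error_le M (noisy F \<xi>) r x ((1 + s) * b + (1 + 1 / s) * (K\<^sup>2 / r\<^sup>2))"
proof -
  have "(\<integral>\<^sup>+\<omega>. ennreal ((norm (noisy F \<xi> \<omega> x /\<^sub>R r - x))\<^sup>2) \<partial>M)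
      \<le> ennreal ((1 + s) * b + (1 + 1 / s) * (K\<^sup>2 / r\<^sup>2))"
  proof (rule mean_sq_error_le_affine[OF F le])
    fix \<omega>
    have "(norm (noisy F \<xi> \<omega> x /\<^sub>R r - x))\<^sup>2 = (norm ((F \<omega> x /\<^sub>R r - x) + \<xi> /\<^sub>R r))\<^sup>2"
      by (simp add: noisy_def algebra_simps)
    also have "\<dots> \<le> (1 + s) * (norm (F \<omega> x /\<^sub>R r - x))\<^sup>2 + (1 + 1 / s) * (norm (\<xi> /\<^sub>R r))\<^sup>2"
      by (rule norm_add_power2_le) fact
    also have "(norm (\<xi> /\<^sub>R r))\<^sup>2 = (norm \<xi>)\<^sup>2 / r\<^sup>2"
      by (simp add: power_mult_distrib power_inverse divide_inverse)
    also have "\<dots> \<le> K\<^sup>2 / r\<^sup>2"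
      using assms by (intro divide_right_mono power_mono) auto
    finally show "(norm (noisy F \<xi> \<omega> x /\<^sub>R r - x))\<^sup>2 \<le>
        (1 + s) * (norm (F \<omega> x /\<^sub>R r - x))\<^sup>2 + (1 + 1 / s) * (K\<^sup>2 / r\<^sup>2)"
      using assms by (simp add: mult_left_mono)
  qed (use assms in auto)
  then show ?thesis
    using assms by (subst mean_sq_error_le_iff_nn_integral[OF random_map_noisy]) auto
qed

text \<open>
  For \<open>\<delta> = 1\<close> the required weight \<open>s\<close> is infinite, so this case is a limit over \<open>s\<close>.
\<close>

lemma mean_sq_error_le_noisy_contraction:
  assumes F: "random_map M F" and le: "mean_sq_error_le M F r x ((1 - \<delta>) * (norm x)\<^sup>2)"
    and \<delta>: "0 < \<delta>" "\<delta> \<le> 1" and \<xi>: "norm \<xi> \<le> K"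
  shows "mean_sq_error_le M (noisy F \<xi>) r x
    ((1 - \<delta> / 2) * (norm x)\<^sup>2 + (2 - \<delta>) * K\<^sup>2 / (\<delta> * r\<^sup>2))"
proof (cases "\<delta> = 1")
  case False
  define s where "s = \<delta> / (2 * (1 - \<delta>))"
  have "0 < s" using \<delta> False by (simp add: s_def)
  have *: "(1 + s) * (1 - \<delta>) = 1 - \<delta> / 2" "1 + 1 / s = (2 - \<delta>) / \<delta>"
    using \<delta> False by (simp_all add: s_def field_simps)
  have "(1 + s) * ((1 - \<delta>) * (norm x)\<^sup>2) + (1 + 1 / s) * (K\<^sup>2 / r\<^sup>2) =
      (1 - \<delta> / 2) * (norm x)\<^sup>2 + (2 - \<delta>) * K\<^sup>2 / (\<delta> * r\<^sup>2)"
    by (simp only: * mult.assoc[symmetric]) simp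
  with mean_sq_error_le_noisy[OF F le _ \<open>0 < s\<close> \<xi>] \<delta> show ?thesis by simp
next
  case True
  \<comment> \<open>At \<delta> = 1 the noiseless error bound is 0, so only the noise term remains,
    for every weight.\<close>
  have *: "mean_sq_error_le M (noisy F \<xi>) r x ((1 + 1 / s) * (K\<^sup>2 / r\<^sup>2))" if "0 < s" for s
    using mean_sq_error_le_noisy[OF F le _ that \<xi>] True by simp
  let ?E = "\<integral>\<omega>. (norm (noisy F \<xi> \<omega> x /\<^sub>R r - x))\<^sup>2 \<partial>M"
  \<comment> \<open>The limit is the additive constant of the claim at \<delta> = 1.\<close>
  have "((\<lambda>s. (1 + 1 / s) * (K\<^sup>2 / r\<^sup>2)) \<longlongrightarrow> (1 + 0) * (K\<^sup>2 / r\<^sup>2)) at_top"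
    by (intro tendsto_intros tendsto_divide_0[OF tendsto_const] filterlim_at_top_imp_at_infinity filterlim_ident)
  then have "?E \<le> (1 + 0) * (K\<^sup>2 / r\<^sup>2)"
    by (rule tendsto_lowerbound) (use * in \<open>auto simp: mean_sq_error_le_def intro!: eventually_mono[OF eventually_gt_at_top[of 0]]\<close>)
  moreover have "0 \<le> (norm x)\<^sup>2 / 2" by simp
  \<comment> \<open>The instance \<open>s = 1\<close> supplies integrability; the bound on the
    integral comes from the limit.\<close>
  ultimately show ?thesis
    using *[of 1] True unfolding mean_sq_error_le_def by (simp add: add_increasing)
qed

section \<open>Compositions of a contraction with a map of bounded error\<close>

text \<open>With \<open>y = G \<nu> x /\<^sub>R q\<close> the error is the sum of
  \<open>F \<mu> y /\<^sub>R r - y\<close> and \<open>y - x\<close>. The bound on the first summand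
  involves the norm of \<open>y\<close>, not of \<open>x\<close>; the second use of Young's
  inequality that repairs this lowers the gain from \<delta> / 4 to \<delta> / 8.\<close>

lemma globally_bounded_compressor_contraction_after:
  assumes F: "random_map M F" and G: "random_map N G"
    and "0 < r" "0 < \<delta>" "\<delta> \<le> 1" "0 \<le> A" "0 < B"
    and leF: "\<And>x. mean_sq_error_le M F r x ((1 - \<delta> / 2) * (norm x)\<^sup>2 + A)"
    and leG: "\<And>x. mean_sq_error_le N G q x B"
  shows "globally_bounded_compressor (M \<Otimes>\<^sub>M N) (\<lambda>(\<mu>, \<nu>) x. F \<mu> (G \<nu> x /\<^sub>R q)) r
    ((4 - \<delta>) * A / (4 - 2 * \<delta>) + (4 - \<delta>) * (12 - \<delta>) * B / (4 * \<delta>)) (\<delta> / 8)"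
proof -
  define s where "s = \<delta> / (4 - 2 * \<delta>)"
  define t where "t = \<delta> / (8 - 2 * \<delta>)"
  have s: "0 < s" "1 + s = (4 - \<delta>) / (4 - 2 * \<delta>)" "1 + 1 / s = (4 - \<delta>) / \<delta>"
    and t: "0 < t" "1 + t = (8 - \<delta>) / (8 - 2 * \<delta>)" "1 + 1 / t = (8 - \<delta>) / \<delta>"
    using assms by (auto simp: s_def t_def field_simps)
  let ?H = "\<lambda>(\<mu>, \<nu>) x. F \<mu> (G \<nu> x /\<^sub>R q)"
  let ?C = "(4 - \<delta>) * A / (4 - 2 * \<delta>) + (4 - \<delta>) * (12 - \<delta>) * B / (4 * \<delta>)"
  have H: "random_map (M \<Otimes>\<^sub>M N) ?H"
    using random_map_compose(1)[OF F random_map_scaleR[OF G]] .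
  have C: "0 < ?C"
    using assms by (intro add_nonneg_pos divide_nonneg_pos divide_pos_pos mult_nonneg_nonneg mult_pos_pos) auto
  interpret M: prob_space M using F by (simp add: random_map_def)
  interpret N: prob_space N using G by (simp add: random_map_def)
  interpret pair_prob_space M N ..
  have "mean_sq_error_le (M \<Otimes>\<^sub>M N) ?H r x ((1 - \<delta> / 8) * (norm x)\<^sup>2 + ?C)" for x
  proof -
    note [measurable] = random_map_measurable[OF H]
    \<comment> \<open>The squared distance of \<open>y\<close> from \<open>x\<close> is paid for
      twice: once for replacing \<open>y\<close> by \<open>x\<close> in the contraction term, once
      for splitting the error.\<close>
    let ?c = "(1 - \<delta> / 4) * (1 + 1 / t) + (1 + 1 / s)"
    let ?k = "(1 - \<delta> / 8) * (norm x)\<^sup>2 + (1 + s) * A"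
    \<comment> \<open>Once \<nu> is fixed, the argument of \<open>F\<close> is deterministic and
      \<open>leF\<close> applies to it.\<close>
    have inner: "(\<integral>\<^sup>+\<mu>. ennreal ((norm (?H (\<mu>, \<nu>) x /\<^sub>R r - x))\<^sup>2) \<partial>M)
        \<le> ennreal (?c * (norm (G \<nu> x /\<^sub>R q - x))\<^sup>2 + ?k)" for \<nu>
    proof -
      let ?y = "G \<nu> x /\<^sub>R q"
      have "(\<integral>\<^sup>+\<mu>. ennreal ((norm (?H (\<mu>, \<nu>) x /\<^sub>R r - x))\<^sup>2) \<partial>M)
          \<le> ennreal ((1 + s) * ((1 - \<delta> / 2) * (norm ?y)\<^sup>2 + A) + (1 + 1 / s) * (norm (?y - x))\<^sup>2)"
      proof (rule mean_sq_error_le_affine[OF F leF])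
        show "(norm (?H (\<mu>, \<nu>) x /\<^sub>R r - x))\<^sup>2
            \<le> (1 + s) * (norm (F \<mu> ?y /\<^sub>R r - ?y))\<^sup>2 + (1 + 1 / s) * (norm (?y - x))\<^sup>2" for \<mu>
          using norm_add_power2_le[OF s(1), of "F \<mu> ?y /\<^sub>R r - ?y" "?y - x"] by simp
      qed (use assms s in auto)
      also have "\<dots> \<le> ennreal (?c * (norm (?y - x))\<^sup>2 + ?k)"
      proof (rule ennreal_leI)
        \<comment> \<open>Each weight spends half of the gain that is left: from \<delta> / 2 to
          \<delta> / 4, then to \<delta> / 8.\<close>
        have *: "(1 + s) * (1 - \<delta> / 2) = 1 - \<delta> / 4" "(1 - \<delta> / 4) * (1 + t) = 1 - \<delta> / 8"
          using assms by (simp_all add: s t field_simps)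
        have "(1 + s) * ((1 - \<delta> / 2) * (norm ?y)\<^sup>2 + A)
            = (1 - \<delta> / 4) * (norm ?y)\<^sup>2 + (1 + s) * A"
          by (simp only: distrib_left[of "1 + s"] mult.assoc[symmetric] *)
        also have "(1 - \<delta> / 4) * (norm ?y)\<^sup>2
            \<le> (1 - \<delta> / 4) * ((1 + t) * (norm x)\<^sup>2 + (1 + 1 / t) * (norm (?y - x))\<^sup>2)"
          using norm_add_power2_le[OF t(1), of x "?y - x"] assms by (intro mult_left_mono) auto
        also have "\<dots> = (1 - \<delta> / 8) * (norm x)\<^sup>2
            + (1 - \<delta> / 4) * (1 + 1 / t) * (norm (?y - x))\<^sup>2"
          unfolding *(2)[symmetric] by (simp only: ring_distribs ac_simps)
        finally show "(1 + s) * ((1 - \<delta> / 2) * (norm ?y)\<^sup>2 + A) + (1 + 1 / s) * (norm (?y - x))\<^sup>2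
            \<le> ?c * (norm (?y - x))\<^sup>2 + ?k"
          by (simp only: distrib_right[of _ _ "(norm (?y - x))\<^sup>2"] add.assoc) linarith
      qed
      finally show ?thesis .
    qed
    have "(\<integral>\<^sup>+p. ennreal ((norm (?H p x /\<^sub>R r - x))\<^sup>2) \<partial>(M \<Otimes>\<^sub>M N))
        = (\<integral>\<^sup>+\<nu>. (\<integral>\<^sup>+\<mu>. ennreal ((norm (?H (\<mu>, \<nu>) x /\<^sub>R r - x))\<^sup>2) \<partial>M) \<partial>N)"
      by (rule nn_integral_snd[symmetric]) measurable
    also have "\<dots> \<le> (\<integral>\<^sup>+\<nu>. ennreal (?c * (norm (G \<nu> x /\<^sub>R q - x))\<^sup>2 + ?k) \<partial>N)"
      by (intro nn_integral_mono inner)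
    also have "\<dots> \<le> ennreal (?c * B + ?k)"
      using assms s(1) t(1) by (intro mean_sq_error_le_affine[OF G leG]) auto
    also have "?c * B + ?k = (1 - \<delta> / 8) * (norm x)\<^sup>2 + ?C"
    proof -
      \<comment> \<open>The two payments are
        \<open>(4 - \<delta>) * (8 - \<delta>) / (4 * \<delta>)\<close> and
        \<open>4 * (4 - \<delta>) / (4 * \<delta>)\<close>.\<close>
      have "?c = (4 - \<delta>) * (12 - \<delta>) / (4 * \<delta>)"
        unfolding s t using assms by (simp add: field_simps)
      then show ?thesis by (simp add: s(2))
    qed
    finally show ?thesis
      using C assms by (subst mean_sq_error_le_iff_nn_integral[OF H]) auto
  qed
  with H C assms show ?thesis
    by (simp add: globally_bounded_compressor_def)
qed

text \<open>The error bound of \<open>G\<close> is uniform in its argument, so one use of Young's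
  inequality suffices and the gain \<delta> / 4 survives. Since \<open>G\<close> acts on the
  unscaled output of \<open>F\<close>, its error is divided by \<open>r\<close> afterwards; hence
  the \<open>r\<^sup>2\<close> below \<open>B\<close>.\<close>

lemma globally_bounded_compressor_contraction_before:
  assumes F: "random_map M F" and G: "random_map N G"
    and "0 < r" "0 < q" "0 < \<delta>" "\<delta> \<le> 1" "0 \<le> A" "0 < B"
    and leF: "\<And>x. mean_sq_error_le M F r x ((1 - \<delta> / 2) * (norm x)\<^sup>2 + A)"
    and leG: "\<And>x. mean_sq_error_le N G q x B"
  shows "globally_bounded_compressor (M \<Otimes>\<^sub>M N) (\<lambda>(\<mu>, \<nu>) x. G \<nu> (F \<mu> x)) (r * q)
    ((4 - \<delta>) * A / (4 - 2 * \<delta>) + (4 - \<delta>) * B / (\<delta> * r\<^sup>2)) (\<delta> / 4)"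
proof -
  define s where "s = \<delta> / (4 - 2 * \<delta>)"
  have s: "0 < s" "1 + s = (4 - \<delta>) / (4 - 2 * \<delta>)" "1 + 1 / s = (4 - \<delta>) / \<delta>"
    using assms by (auto simp: s_def field_simps)
  let ?H = "\<lambda>(\<mu>, \<nu>) x. G \<nu> (F \<mu> x)"
  let ?C = "(4 - \<delta>) * A / (4 - 2 * \<delta>) + (4 - \<delta>) * B / (\<delta> * r\<^sup>2)"
  have H: "random_map (M \<Otimes>\<^sub>M N) ?H"
    using random_map_compose(2)[OF F G] .
  have C: "0 < ?C"
    using assms by (intro add_nonneg_pos divide_nonneg_pos divide_pos_pos mult_nonneg_nonneg mult_pos_pos) auto
  interpret M: prob_space M using F by (simp add: random_map_def)
  interpret N: prob_space N using G by (simp add: random_map_def)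
  interpret pair_prob_space M N ..
  have "mean_sq_error_le (M \<Otimes>\<^sub>M N) ?H (r * q) x ((1 - \<delta> / 4) * (norm x)\<^sup>2 + ?C)" for x
  proof -
    note [measurable] = random_map_measurable[OF H]
    let ?k = "(1 + 1 / s) / r\<^sup>2 * B"
    have inner: "(\<integral>\<^sup>+\<nu>. ennreal ((norm (?H (\<mu>, \<nu>) x /\<^sub>R (r * q) - x))\<^sup>2) \<partial>N)
        \<le> ennreal ((1 + 1 / s) / r\<^sup>2 * B + (1 + s) * (norm (F \<mu> x /\<^sub>R r - x))\<^sup>2)" for \<mu>
    proof (rule mean_sq_error_le_affine[OF G leG])
      fix \<nu>
      let ?z = "F \<mu> x"
      have "?H (\<mu>, \<nu>) x /\<^sub>R (r * q) - x = (?z /\<^sub>R r - x) + (G \<nu> ?z /\<^sub>R q - ?z) /\<^sub>R r"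
        by (simp add: algebra_simps)
      then have "(norm (?H (\<mu>, \<nu>) x /\<^sub>R (r * q) - x))\<^sup>2 \<le> (1 + s) * (norm (?z /\<^sub>R r - x))\<^sup>2
          + (1 + 1 / s) * (norm ((G \<nu> ?z /\<^sub>R q - ?z) /\<^sub>R r))\<^sup>2"
        by (simp only: norm_add_power2_le[OF s(1)])
      also have "(norm ((G \<nu> ?z /\<^sub>R q - ?z) /\<^sub>R r))\<^sup>2 = (norm (G \<nu> ?z /\<^sub>R q - ?z))\<^sup>2 / r\<^sup>2"
        by (simp only: norm_scaleR power_mult_distrib) (simp add: power_inverse divide_inverse)
      finally show "(norm (?H (\<mu>, \<nu>) x /\<^sub>R (r * q) - x))\<^sup>2
          \<le> (1 + 1 / s) / r\<^sup>2 * (norm (G \<nu> ?z /\<^sub>R q - ?z))\<^sup>2 + (1 + s) * (norm (?z /\<^sub>R r - x))\<^sup>2"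
        by (simp only: times_divide_eq_left times_divide_eq_right add.commute)
    qed (use assms s(1) in auto)
    \<comment> \<open>Tonelli is now applied with \<open>N\<close> innermost, since \<open>G\<close>
      is the outer map.\<close>
    have "(\<integral>\<^sup>+p. ennreal ((norm (?H p x /\<^sub>R (r * q) - x))\<^sup>2) \<partial>(M \<Otimes>\<^sub>M N))
        = (\<integral>\<^sup>+\<mu>. (\<integral>\<^sup>+\<nu>. ennreal ((norm (?H (\<mu>, \<nu>) x /\<^sub>R (r * q) - x))\<^sup>2) \<partial>N) \<partial>M)"
      by (rule N.nn_integral_fst[symmetric]) measurable
    also have "\<dots> \<le> (\<integral>\<^sup>+\<mu>. ennreal (?k + (1 + s) * (norm (F \<mu> x /\<^sub>R r - x))\<^sup>2) \<partial>M)"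
      by (intro nn_integral_mono inner)
    also have "\<dots> \<le> ennreal ((1 + s) * ((1 - \<delta> / 2) * (norm x)\<^sup>2 + A) + ?k)"
      using assms s(1) by (intro mean_sq_error_le_affine[OF F leF]) auto
    also have "(1 + s) * ((1 - \<delta> / 2) * (norm x)\<^sup>2 + A) + ?k = (1 - \<delta> / 4) * (norm x)\<^sup>2 + ?C"
    proof -
      have "(1 + s) * (1 - \<delta> / 2) = 1 - \<delta> / 4"
        using assms by (simp add: s field_simps)
      then show ?thesis
        by (simp only: distrib_left mult.assoc[symmetric]) (simp add: s)
    qed
    finally show ?thesis
      using C assms by (subst mean_sq_error_le_iff_nn_integral[OF H]) auto
  qed
  with H C assms show ?thesis
    by (simp add: globally_bounded_compressor_def)
qed

text \<open>The two noise vectors are arbitrary under a common bound, so one realization shared by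
  both maps is the case of equal vectors.\<close>

theorem lemma2:
  fixes M\<^sub>r :: "'u measure" and M\<^sub>a :: "'v measure"
    and \<C>\<^sub>r :: "'u \<Rightarrow> real^'d \<Rightarrow> real^'d" and \<C>\<^sub>a :: "'v \<Rightarrow> real^'d \<Rightarrow> real^'d"
    and \<xi>\<^sub>r \<xi>\<^sub>a :: "real^'d"
    and r\<^sub>r r\<^sub>a \<delta>\<^sub>r C\<^sub>a C\<^sub>\<xi> D\<^sub>r D\<^sub>a :: real
  assumes "random_map M\<^sub>r \<C>\<^sub>r" and "random_map M\<^sub>a \<C>\<^sub>a"
    and "0 < r\<^sub>r" and "0 < r\<^sub>a" and "0 < \<delta>\<^sub>r" and "\<delta>\<^sub>r \<le> 1" and "0 < C\<^sub>a"
    and "\<And>x. mean_sq_error_le M\<^sub>r \<C>\<^sub>r r\<^sub>r x ((1 - \<delta>\<^sub>r) * (norm x)\<^sup>2)"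
    and "\<And>x. mean_sq_error_le M\<^sub>a \<C>\<^sub>a r\<^sub>a x C\<^sub>a"
    and "norm \<xi>\<^sub>r \<le> C\<^sub>\<xi>" and "norm \<xi>\<^sub>a \<le> C\<^sub>\<xi>"
    and "D\<^sub>r = (2 - \<delta>\<^sub>r) * C\<^sub>\<xi>\<^sup>2 / (\<delta>\<^sub>r * r\<^sub>r\<^sup>2)"
    and "D\<^sub>a = 2 * C\<^sub>a + 2 * C\<^sub>\<xi>\<^sup>2 / r\<^sub>a\<^sup>2"
  shows "globally_bounded_compressor (M\<^sub>r \<Otimes>\<^sub>M M\<^sub>a)
           (\<lambda>(\<omega>\<^sub>r, \<omega>\<^sub>a) x. noisy \<C>\<^sub>r \<xi>\<^sub>r \<omega>\<^sub>r (noisy \<C>\<^sub>a \<xi>\<^sub>a \<omega>\<^sub>a x /\<^sub>R r\<^sub>a))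
           r\<^sub>r
           ((4 - \<delta>\<^sub>r) * D\<^sub>r / (4 - 2 * \<delta>\<^sub>r) + (4 - \<delta>\<^sub>r) * (12 - \<delta>\<^sub>r) * D\<^sub>a / (4 * \<delta>\<^sub>r))
           (\<delta>\<^sub>r / 8) \<and>
         globally_bounded_compressor (M\<^sub>r \<Otimes>\<^sub>M M\<^sub>a)
           (\<lambda>(\<omega>\<^sub>r, \<omega>\<^sub>a) x. noisy \<C>\<^sub>a \<xi>\<^sub>a \<omega>\<^sub>a (noisy \<C>\<^sub>r \<xi>\<^sub>r \<omega>\<^sub>r x))
           (r\<^sub>r * r\<^sub>a)
           ((4 - \<delta>\<^sub>r) * D\<^sub>r / (4 - 2 * \<delta>\<^sub>r) + (4 - \<delta>\<^sub>r) * D\<^sub>a / (\<delta>\<^sub>r * r\<^sub>r\<^sup>2))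
           (\<delta>\<^sub>r / 4)"
proof -
  have leF: "mean_sq_error_le M\<^sub>r (noisy \<C>\<^sub>r \<xi>\<^sub>r) r\<^sub>r x ((1 - \<delta>\<^sub>r / 2) * (norm x)\<^sup>2 + D\<^sub>r)" for x
    unfolding assms(12) by (rule mean_sq_error_le_noisy_contraction) (use assms in auto)
  \<comment> \<open>There is no contraction to preserve here; the weight \<open>s = 1\<close>
    produces both factors 2 in \<open>D\<^sub>a\<close>.\<close>
  have leG: "mean_sq_error_le M\<^sub>a (noisy \<C>\<^sub>a \<xi>\<^sub>a) r\<^sub>a x D\<^sub>a" for x
    using mean_sq_error_le_noisy[of M\<^sub>a \<C>\<^sub>a r\<^sub>a x C\<^sub>a 1 \<xi>\<^sub>a C\<^sub>\<xi>] assms by simp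
  have "0 \<le> D\<^sub>r" "0 < D\<^sub>a"
    using assms by (simp_all add: add_pos_nonneg)
  with assms leF leG show ?thesis
    by (intro conjI globally_bounded_compressor_contraction_after
        globally_bounded_compressor_contraction_before random_map_noisy) auto
qed

end
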